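(* Let $K\subset\mathbb{C}\cong\mathbb{R}^2$ be a convex body with boundary curve $\gamma:=\partial K$, let $\tau>0$ and $0<\varphi<\pi/4$. Let $\mathbf{n}$ be the (multivalued) function of outer unit normals of $\gamma$ and assume that $\omega(\mathbf{n},\tau)\le\varphi<\pi/4$. Put $k:=\lfloor \frac{\pi}{2\varphi}\rfloor$. If $\mathbf{x}\in\partial K=\gamma$ and $\mathbf{n}_0=(\sin\alpha,-\cos\alpha)\in\mathbf{n}(\mathbf{x})$ is an outer unit normal to $\gamma$ at $\mathbf{x}$, then $M(\mathbf{x},\alpha,\varphi,\tau)\subset K$.
   Context: A planar convex body is a compact convex subset of $\mathbb{R}^2$ with nonempty interior. For $\mathbf{x}\in\partial K$, $\mathbf{n}(\mathbf{x})\subset S^1$ is the nonempty set of all outer unit normal vectors of $K$ at $\mathbf{x}$. The modulus of continuity (with respect to chord length) is $$\omega(\mathbf{n},\tau):=\sup\{\arccos\langle\mathbf{u},\mathbf{w}\rangle:\ \mathbf{x},\mathbf{y}\in\partial K,\ |\mathbf{x}-\mathbf{y}|\le\tau,\ \mathbf{u}\in\mathbf{n}(\mathbf{x}),\ \mathbf{w}\in\mathbf{n}(\mathbf{y})\}.$$ Mangled $n$-gons. For $k\in\mathbb{N}$, $k\ge2$, put $\varphi^*:=\frac{\pi}{2k}$ and, for $m\in\{1,\dots,4k\}\setminus\{k,2k,3k,4k\}$, $$A_m:=\Big(\sum_{j=1}^m\cos(j\varphi^* )-\sum_{\ell=1}^{\lfloor m/k\rfloor}\cos(\ell k\varphi^*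 ),\ \sum_{j=1}^m\sin(j\varphi^* )-\sum_{\ell=1}^{\lfloor m/k\rfloor}\sin(\ell k\varphi^* )\Big).$$ The standard mangled $n$-gon ($n=4k-4$) $M_k$ is the convex hull of all these points $A_m$ (so the origin $O=A_{4k-1}$ is one of its vertices). For $\tau>0$, $\alpha\in\mathbb{R}$, $\mathbf{x}\in\mathbb{R}^2$, $\varphi\in(0,\pi/4]$, with $k:=\lfloor\frac{\pi}{2\varphi}\rfloor$, define $$M(\mathbf{x},\alpha,\varphi,\tau):=U_\alpha(\tau M_k)+\mathbf{x},$$ where $U_\alpha$ is the counterclockwise rotation of $\mathbb{R}^2$ about the origin by angle $\alpha$. *)

theory Defs
  imports "HOL-Analysis.Analysis"
begin

text \<open>The plane \<open>\<real>\<^sup>2\<close> is identified with the type \<^typ>\<open>complex\<close>.\<close>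

definition planar_convex_body :: "complex set \<Rightarrow> bool" where
  "planar_convex_body K \<longleftrightarrow> compact K \<and> convex K \<and> interior K \<noteq> {}"

definition outer_unit_normals :: "complex set \<Rightarrow> complex \<Rightarrow> complex set" where
  "outer_unit_normals K x = {u. norm u = 1 \<and> (\<forall>y\<in>K. u \<bullet> (y - x) \<le> 0)}"

text \<open>For a planar convex body and \<open>\<tau> \<ge> 0\<close>, the set below is nonempty (each boundary point has
  an outer normal) and contained in \<open>[0, \<pi>]\<close>, so the real \<^const>\<open>Sup\<close> is the genuine supremum.\<close>

definition normal_modulus :: "complex set \<Rightarrow> real \<Rightarrow> real" where
  "normal_modulus K \<tau> = Sup {arccos (u \<bullet> w) | x y u w.
     x \<in> frontier K \<and> y \<in> frontier K \<and> dist x y \<le> \<tau> \<and>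
     u \<in> outer_unit_normals K x \<and> w \<in> outer_unit_normals K y}"

text \<open>On natural numbers \<open>m div k\<close> is \<open>\<lfloor>m/k\<rfloor>\<close>.\<close>

definition mangled_vertex :: "nat \<Rightarrow> nat \<Rightarrow> complex" where
  "mangled_vertex k m = (let \<phi> = pi / (2 * real k) in
     Complex ((\<Sum>j=1..m. cos (real j * \<phi>)) - (\<Sum>l=1..m div k. cos (real l * real k * \<phi>)))
             ((\<Sum>j=1..m. sin (real j * \<phi>)) - (\<Sum>l=1..m div k. sin (real l * real k * \<phi>))))"

definition standard_mangled_gon :: "nat \<Rightarrow> complex set" where
  "standard_mangled_gon k =
     convex hull (mangled_vertex k ` ({1..4 * k} - {k, 2 * k, 3 * k, 4 * k}))"

text \<open>Multiplication by \<^term>\<open>cis \<alpha>\<close> is the counterclockwise rotation by \<open>\<alpha>\<close> about the origin.\<close>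

definition mangled_gon :: "complex \<Rightarrow> real \<Rightarrow> real \<Rightarrow> real \<Rightarrow> complex set" where
  "mangled_gon x \<alpha> \<phi> \<tau> =
     (let k = nat \<lfloor>pi / (2 * \<phi>)\<rfloor>
      in (\<lambda>z. cis \<alpha> * (\<tau> *\<^sub>R z) + x) ` standard_mangled_gon k)"

end

theory Submission
  imports Defs
begin

text \<open>
  Let \<open>h = \<pi> / (2k) \<ge> \<phi>\<close>. Boundary points of \<open>K\<close> whose normals differ by more than \<open>\<phi>\<close> are more than
  \<open>\<tau>\<close> apart, so in the limit one can walk along the boundary from \<open>x\<close> through points
  with normals at the angles \<open>h, 2h, \<dots>\<close> (relative to the normal at \<open>x\<close>), each step being a chord of length
  at least \<open>\<tau>\<close>. The \<open>j\<close>-th chord lies in the cone spanned by the tangents at \<open>(j - 1)h\<close> and \<open>jh\<close>, so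
  at the normal angle \<open>t \<in> [0, \<pi>]\<close> it contributes at least
  \<open>\<tau> min (sin (t - (j - 1)h)) (sin (t - jh))\<close> to the support function of \<open>K\<close> about \<open>x\<close>, while the
  \<open>j\<close>-th edge of the mangled polygon contributes \<open>\<tau> sin (t - jh)\<close>. Past the peak of the sine the two
  agree; before it they are shifted by one index, which costs at most one term, i.e. at most \<open>1\<close>. The
  deleted edges \<open>j = 0\<close> and \<open>j = k\<close> pay for this loss: \<open>sin t + sin (t - \<pi>/2) \<ge> 1\<close> for
  \<open>t \<in> [\<pi>/2, \<pi>]\<close>. The angles \<open>t \<in> [-\<pi>, 0]\<close> follow by reflection in the imaginary axis,
  and the separation theorem turns the comparison of support functions into the inclusion.
\<close>

section \<open>Unit normals parametrised by angle\<close>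

text \<open>This is \<open>- \<i> * cis t\<close>, the outer normal at a point where the
  counterclockwise boundary has tangent direction \<open>cis t\<close>.\<close>

definition normal_at :: "real \<Rightarrow> complex" where
  "normal_at t = Complex (sin t) (- cos t)"

lemma norm_normal_at [simp]: "norm (normal_at t) = 1"
  by (simp add: normal_at_def cmod_def)

lemma inner_normal_at_cis: "normal_at a \<bullet> cis b = sin (a - b)"
  by (simp add: normal_at_def inner_complex_def sin_diff)

lemma inner_normal_at: "normal_at a \<bullet> normal_at b = cos (b - a)"
  by (simp add: normal_at_def inner_complex_def cos_diff)

lemma continuous_normal_at [continuous_intros]:
  "continuous F f \<Longrightarrow> continuous F (\<lambda>x. normal_at (f x))"
  unfolding normal_at_def Complex_eq by (intro continuous_intros)

lemma inner_cis_mult: "normal_at (a + t) \<bullet> (cis a * w) = normal_at t \<bullet> w"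
proof -
  have "normal_at (a + t) \<bullet> (cis a * w) = ((cos a)\<^sup>2 + (sin a)\<^sup>2) * (normal_at t \<bullet> w)"
    unfolding normal_at_def inner_complex_def complex.sel times_complex.sel cis.sel sin_add cos_add
    by algebra
  then show ?thesis by simp
qed

lemma polar_normal_at:
  assumes "v \<noteq> 0"
  obtains t where "- pi < t" "t \<le> pi" "v = norm v *\<^sub>R normal_at (a + t)"
proof
  \<comment> \<open>As \<open>normal_at s\<close> is \<open>- \<i> * cis s\<close>, multiplying
    \<open>v\<close> by \<open>\<i>\<close> and rotating by \<open>- a\<close> must leave a vector
    with argument \<open>t\<close>.\<close>
  let ?t = "Arg (\<i> * v * cis (- a))"
  show "- pi < ?t" "?t \<le> pi" using Arg_bounded by auto
  have "cis ?t = sgn (\<i> * v * cis (- a))" using assms by (intro cis_Arg) simp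
  then have "norm v *\<^sub>R cis ?t = \<i> * v * cis (- a)"
    using assms by (simp add: sgn_div_norm norm_mult)
  then have "norm v *\<^sub>R (- \<i> * (cis a * cis ?t)) = - \<i> * (cis a * (\<i> * v * cis (- a)))"
    by (metis mult_scaleR_right)
  also have "\<dots> = v * (cis a * cis (- a))" by (simp add: algebra_simps flip: power2_eq_square)
  also have "\<dots> = v" by (simp add: cis_mult)
  finally show "v = norm v *\<^sub>R normal_at (a + ?t)"
    by (simp add: cis_mult normal_at_def complex_eq_iff)
qed

section \<open>Chords in a tangent cone\<close>

text \<open>Cramer's rule, cleared of denominators: \<open>normal_at a\<close> is orthogonal to
  \<open>cis a\<close>, so pairing with it isolates the coordinate along \<open>cis b\<close>, and
  vice versa.\<close>

lemma cone_decomposition: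
  "sin (b - a) *\<^sub>R c = (normal_at b \<bullet> c) *\<^sub>R cis a - (normal_at a \<bullet> c) *\<^sub>R cis b"
  unfolding complex_eq_iff normal_at_def inner_complex_def
  by (simp add: sin_diff algebra_simps)

text \<open>The sign conditions make both coordinates of \<open>c\<close> along \<open>cis a\<close>
  and \<open>cis b\<close> nonnegative. By the triangle inequality they add up to at least
  \<open>norm c\<close>, and each is weighted by a sine that is at least \<open>m\<close>.\<close>

lemma inner_chord_ge:
  assumes "0 < b - a" "b - a < pi" "normal_at a \<bullet> c \<le> 0" "0 \<le> normal_at b \<bullet> c" "\<tau> \<le> norm c"
    and "0 \<le> m" "m \<le> sin (t - a)" "m \<le> sin (t - b)"
  shows "\<tau> * m \<le> normal_at t \<bullet> c"
proof -
  define A where "A = (normal_at b \<bullet> c) / sin (b - a)"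
  define B where "B = - (normal_at a \<bullet> c) / sin (b - a)"
  have s: "sin (b - a) > 0" using assms by (intro sin_gt_zero)
  have AB: "A \<ge> 0" "B \<ge> 0" using assms s by (auto simp: A_def B_def divide_nonpos_pos)
  have "c = (1 / sin (b - a)) *\<^sub>R (sin (b - a) *\<^sub>R c)" using s by simp
  also have "\<dots> = A *\<^sub>R cis a + B *\<^sub>R cis b"
    unfolding cone_decomposition by (simp add: A_def B_def algebra_simps)
  finally have c: "c = A *\<^sub>R cis a + B *\<^sub>R cis b" .
  have "norm c \<le> A + B"
    unfolding c using norm_triangle_ineq[of "A *\<^sub>R cis a" "B *\<^sub>R cis b"] AB by simp
  then have "\<tau> * m \<le> (A + B) * m" using assms by (intro mult_right_mono) auto
  also have "\<dots> \<le> A * sin (t - a) + B * sin (t - b)"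
    using AB assms by (auto simp: algebra_simps intro!: add_mono mult_left_mono)
  also have "\<dots> = normal_at t \<bullet> c"
    by (subst c) (simp add: inner_add_right inner_normal_at_cis)
  finally show ?thesis .
qed

section \<open>Walking along the boundary\<close>

text \<open>The modulus bound rephrased in angles. The gap must exceed \<open>h\<close> strictly,
  since a bound on the modulus rules out only larger gaps; up to \<open>pi\<close> the gap is the
  true angle between the normals.\<close>

definition chord_condition :: "complex set \<Rightarrow> real \<Rightarrow> real \<Rightarrow> bool" where
  "chord_condition K h \<tau> \<longleftrightarrow> (\<forall>a b p q. p \<in> K \<longrightarrow> q \<in> K \<longrightarrow>
     normal_at a \<in> outer_unit_normals K p \<longrightarrow> normal_at b \<in> outer_unit_normals K q \<longrightarrow>
     h < b - a \<longrightarrow> b - a \<le> pi \<longrightarrow> \<tau> \<le> dist p q)"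

lemma exists_point_with_normal:
  assumes "compact K" "K \<noteq> {}"
  obtains p where "p \<in> K" "normal_at a \<in> outer_unit_normals K p"
proof -
  have "\<exists>p\<in>K. \<forall>y\<in>K. normal_at a \<bullet> y \<le> normal_at a \<bullet> p"
    using assms by (intro continuous_attains_sup continuous_intros)
  then show ?thesis using that by (auto simp: outer_unit_normals_def inner_diff_right)
qed

lemma outer_normal_imp_frontier:
  assumes "p \<in> K" "u \<in> outer_unit_normals K p"
  shows "p \<in> frontier K"
proof (rule ccontr)
  assume "p \<notin> frontier K"
  then have "p \<in> interior K" using assms closure_subset by (auto simp: frontier_def)
  then obtain e where e: "e > 0" "cball p e \<subseteq> K" using mem_interior_cball by blast
  have u: "norm u = 1" using assms by (simp add: outer_unit_normals_def)
  have "p + e *\<^sub>R u \<in> K" using e u by (auto simp: dist_norm)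
  then have "u \<bullet> (e *\<^sub>R u) \<le> 0" using assms(2) by (fastforce simp: outer_unit_normals_def)
  then show False using e u by (simp add: dot_square_norm)
qed

text \<open>Points closer than \<open>\<tau>\<close> enter the set defining the modulus, so the
  angle between their normals is at most \<open>\<phi> \<le> h\<close>.\<close>

lemma chord_condition_modulus:
  assumes "planar_convex_body K" "normal_modulus K \<tau> \<le> \<phi>" "\<phi> \<le> h"
    and "0 \<le> h"
  shows "chord_condition K h \<tau>"
  unfolding chord_condition_def
proof (intro allI impI)
  fix a b p q
  assume pq: "p \<in> K" "q \<in> K" "normal_at a \<in> outer_unit_normals K p"
     "normal_at b \<in> outer_unit_normals K q" "h < b - a" "b - a \<le> pi"
  show "\<tau> \<le> dist p q"
  proof (rule ccontr)
    assume d: "\<not> \<tau> \<le> dist p q"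
    let ?S = "{arccos (u \<bullet> w) | x y u w.
     x \<in> frontier K \<and> y \<in> frontier K \<and> dist x y \<le> \<tau> \<and>
     u \<in> outer_unit_normals K x \<and> w \<in> outer_unit_normals K y}"
    \<comment> \<open>The real supremum is known to be an upper bound only once the set is bounded
      above.\<close>
    have "s \<le> pi" if s_in: "s \<in> ?S" for s
    proof -
      obtain u w :: complex where s: "s = arccos (u \<bullet> w)" "norm u = 1" "norm w = 1"
        using s_in unfolding outer_unit_normals_def by blast
      have "\<bar>u \<bullet> w\<bar> \<le> 1" using Cauchy_Schwarz_ineq2[of u w] s by simp
      then show ?thesis using s by (auto intro!: arccos_ubound)
    qed
    then have "bdd_above ?S" by (intro bdd_aboveI)
    moreover have "arccos (normal_at a \<bullet> normal_at b) \<in> ?S"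
      using pq d outer_normal_imp_frontier[OF pq(1,3)] outer_normal_imp_frontier[OF pq(2,4)]
      unfolding mem_Collect_eq by (intro exI[of _ p] exI[of _ q] exI conjI refl) auto
    ultimately have "arccos (normal_at a \<bullet> normal_at b) \<le> normal_modulus K \<tau>"
      unfolding normal_modulus_def by (rule cSup_upper[rotated])
    moreover have "arccos (normal_at a \<bullet> normal_at b) = b - a"
      unfolding inner_normal_at using pq assms by (intro arccos_cos) auto
    ultimately show False using pq assms by simp
  qed
qed

text \<open>The chord condition is silent about a gap of exactly \<open>h\<close>, so gaps slightly
  above \<open>h\<close> are used and compactness gives a limit point. The normal inequality and the
  distance bound are closed conditions and survive the limit.\<close>

lemma next_point:
  assumes "compact K" "chord_condition K h \<tau>" "0 < h" "h < pi"
    and p: "p \<in> K" "normal_at a \<in> outer_unit_normals K p"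
  obtains q where "q \<in> K" "normal_at (a + h) \<in> outer_unit_normals K q" "\<tau> \<le> dist p q"
proof -
  \<comment> \<open>The numerator keeps even the largest gap, \<open>h + e 0\<close>, at most
    \<open>pi\<close>.\<close>
  define e where "e n = (pi - h) / real (Suc n)" for n
  have e: "0 < e n" "e n \<le> pi - h" for n
    using assms by (auto simp: e_def divide_le_eq mult_le_cancel_left1)
  have e0: "e \<longlonglongrightarrow> 0" unfolding e_def
    by (rule LIMSEQ_Suc[OF lim_const_over_n])
  have "\<exists>q. q \<in> K \<and> normal_at (a + h + e n) \<in> outer_unit_normals K q" for n
    using exists_point_with_normal[OF assms(1)] p by blast
  then obtain Q where Q: "\<And>n. Q n \<in> K" "\<And>n. normal_at (a + h + e n) \<in> outer_unit_normals K (Q n)"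
    by metis
  have d: "\<tau> \<le> dist p (Q n)" for n
  proof -
    have "h < a + h + e n - a" "a + h + e n - a \<le> pi" using e[of n] by auto
    then show ?thesis
      using assms(2) Q[of n] p unfolding chord_condition_def by blast
  qed
  obtain q r where q: "q \<in> K" and r: "strict_mono (r :: nat \<Rightarrow> nat)" and lim: "(Q \<circ> r) \<longlonglongrightarrow> q"
    using assms(1) Q(1) unfolding compact_def by blast
  have er: "(\<lambda>n. e (r n)) \<longlonglongrightarrow> 0"
    using LIMSEQ_subseq_LIMSEQ[OF e0 r] by (simp add: o_def)
  have Qr: "(\<lambda>n. Q (r n)) \<longlonglongrightarrow> q" using lim by (simp add: o_def)
  have N: "(\<lambda>n. normal_at (a + h + e (r n))) \<longlonglongrightarrow> normal_at (a + h)"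
  proof -
    have "isCont normal_at (a + h)" by (intro continuous_intros)
    moreover have "(\<lambda>n. a + h + e (r n)) \<longlonglongrightarrow> a + h"
      using tendsto_add[OF tendsto_const er, of "a + h"] by simp
    ultimately show ?thesis by (rule isCont_tendsto_compose)
  qed
  have "normal_at (a + h) \<bullet> (y - q) \<le> 0" if "y \<in> K" for y
  proof (rule LIMSEQ_le_const2)
    show "(\<lambda>n. normal_at (a + h + e (r n)) \<bullet> (y - Q (r n))) \<longlonglongrightarrow> normal_at (a + h) \<bullet> (y - q)"
      by (intro tendsto_intros N Qr)
    show "\<exists>N. \<forall>n\<ge>N. normal_at (a + h + e (r n)) \<bullet> (y - Q (r n)) \<le> 0"
      using Q(2) that by (auto simp: outer_unit_normals_def)
  qed
  moreover have "\<tau> \<le> dist p q"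
    by (rule LIMSEQ_le_const[OF tendsto_dist[OF tendsto_const Qr]]) (use d in auto)
  ultimately show ?thesis using that q by (auto simp: outer_unit_normals_def)
qed

text \<open>Each step appends a chord from \<open>next_point\<close>, estimated by
  \<open>inner_chord_ge\<close>. The normal at \<open>p\<close> is carried along so that the next
  step can start there.\<close>

lemma support_ge_sum_min:
  assumes "compact K" "chord_condition K h \<tau>" "0 < h" "h < pi"
    and x: "x \<in> K" "normal_at \<alpha> \<in> outer_unit_normals K x"
    and "real N * h \<le> t" "t \<le> pi"
  shows "\<exists>p\<in>K. normal_at (\<alpha> + real N * h) \<in> outer_unit_normals K p \<and>
    \<tau> * (\<Sum>j<N. min (sin (t - real j * h)) (sin (t - real (Suc j) * h)))
      \<le> normal_at (\<alpha> + t) \<bullet> (p - x)"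
  using assms(7)
proof (induction N)
  case 0
  then show ?case using x by auto
next
  case (Suc N)
  have "real N * h \<le> real (Suc N) * h" using assms by simp
  then have "real N * h \<le> t" using Suc.prems by linarith
  then obtain p where p: "p \<in> K" "normal_at (\<alpha> + real N * h) \<in> outer_unit_normals K p"
    "\<tau> * (\<Sum>j<N. min (sin (t - real j * h)) (sin (t - real (Suc j) * h)))
      \<le> normal_at (\<alpha> + t) \<bullet> (p - x)"
    using Suc.IH by blast
  obtain q where q: "q \<in> K" "normal_at (\<alpha> + real N * h + h) \<in> outer_unit_normals K q"
    "\<tau> \<le> dist p q"
    using next_point[OF assms(1-4) p(1,2)] by blast
  have eq: "\<alpha> + real N * h + h = \<alpha> + real (Suc N) * h" by (simp add: algebra_simps)
  let ?m = "min (sin (t - real N * h)) (sin (t - real (Suc N) * h))"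
  have "0 \<le> real N * h" "0 \<le> real (Suc N) * h" using assms by auto
  then have "0 \<le> ?m"
    using Suc.prems \<open>real N * h \<le> t\<close> \<open>t \<le> pi\<close> by (auto intro!: sin_ge_zero simp del: of_nat_Suc)
  have "\<tau> * ?m \<le> normal_at (\<alpha> + t) \<bullet> (q - p)"
  proof (rule inner_chord_ge[where a = "\<alpha> + real N * h" and b = "\<alpha> + real (Suc N) * h"])
    show "normal_at (\<alpha> + real N * h) \<bullet> (q - p) \<le> 0"
      using p q by (auto simp: outer_unit_normals_def)
    have "normal_at (\<alpha> + real (Suc N) * h) \<bullet> (p - q) \<le> 0"
      using p q unfolding eq by (auto simp: outer_unit_normals_def)
    then show "0 \<le> normal_at (\<alpha> + real (Suc N) * h) \<bullet> (q - p)" by (simp add: inner_diff_right)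
    show "\<tau> \<le> norm (q - p)" using q(3) by (simp add: dist_norm norm_minus_commute)
  qed (use assms \<open>0 \<le> ?m\<close> in \<open>auto simp: algebra_simps\<close>)
  then have "\<tau> * (\<Sum>j<Suc N. min (sin (t - real j * h)) (sin (t - real (Suc j) * h)))
      \<le> normal_at (\<alpha> + t) \<bullet> (q - x)"
    using p(3) by (simp add: algebra_simps inner_diff_right del: of_nat_Suc)
  then show ?case using q unfolding eq by blast
qed

section \<open>Comparing sums of sines\<close>

text \<open>The first conjunct serves the induction: while the arguments stay at least
  \<open>pi / 2\<close>, each minimum is its left sine. The step across \<open>pi / 2\<close> costs
  at most 1; afterwards both sides of the second conjunct gain the same term.\<close>

lemma sum_min_sin_ge:
  assumes "0 < h" "real N * h \<le> t" "t \<le> pi"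
  shows "(pi / 2 \<le> t - real N * h \<longrightarrow> (\<Sum>j<N. sin (t - real j * h)) \<le>
            (\<Sum>j<N. min (sin (t - real j * h)) (sin (t - real (Suc j) * h)))) \<and>
    (\<Sum>j\<le>N. sin (t - real j * h)) - 1 \<le>
      (\<Sum>j<N. min (sin (t - real j * h)) (sin (t - real (Suc j) * h)))"
  using assms(2)
proof (induction N)
  case 0
  then show ?case by simp
next
  case (Suc N)
  define u v where "u = t - real N * h" and "v = t - real (Suc N) * h"
  have uv: "v < u" "0 \<le> v" "u \<le> pi"
  proof -
    have "0 \<le> real N * h" "real (Suc N) * h = real N * h + h" using assms by (simp_all add: algebra_simps)
    then show "v < u" "0 \<le> v" "u \<le> pi" using assms Suc.prems unfolding u_def v_def by linarith+
  qed
  have IH: "(pi / 2 \<le> u \<longrightarrow> (\<Sum>j<N. sin (t - real j * h)) \<le>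
            (\<Sum>j<N. min (sin (t - real j * h)) (sin (t - real (Suc j) * h))))"
    "(\<Sum>j\<le>N. sin (t - real j * h)) - 1 \<le>
      (\<Sum>j<N. min (sin (t - real j * h)) (sin (t - real (Suc j) * h)))"
    using Suc.IH uv unfolding u_def v_def by auto
  have A: "sin u \<le> sin v" if "pi / 2 \<le> v"
    using sin_monotone_2pi_le[of "pi - u" "pi - v"] uv that by simp
  have B: "sin v \<le> sin u" if "u \<le> pi / 2"
    using sin_monotone_2pi_le[of v u] uv that by simp
  have m: "(\<Sum>j<Suc N. min (sin (t - real j * h)) (sin (t - real (Suc j) * h))) =
    (\<Sum>j<N. min (sin (t - real j * h)) (sin (t - real (Suc j) * h))) + min (sin u) (sin v)"
    by (simp add: u_def v_def)
  have s: "(\<Sum>j\<le>Suc N. sin (t - real j * h)) = (\<Sum>j\<le>N. sin (t - real j * h)) + sin v"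
      "(\<Sum>j\<le>N. sin (t - real j * h)) = (\<Sum>j<N. sin (t - real j * h)) + sin u"
      "(\<Sum>j<Suc N. sin (t - real j * h)) = (\<Sum>j<N. sin (t - real j * h)) + sin u"
    by (simp_all add: u_def v_def lessThan_Suc_atMost[symmetric] del: of_nat_Suc)
  \<comment> \<open>Dropping the larger of the two sines costs at most 1.\<close>
  have le: "sin u + sin v - 1 \<le> min (sin u) (sin v)" by simp
  have up: "min (sin u) (sin v) = sin u" if "pi / 2 \<le> v" using A[OF that] by simp
  have down: "min (sin u) (sin v) = sin v" if "u \<le> pi / 2" using B[OF that] by simp
  show ?case
    unfolding m s(1,3) v_def[symmetric]
  proof (intro conjI impI, goal_cases)
    case 1
    then show ?case using IH(1) up uv by linarith
  next
    case 2
    show ?case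
    proof (cases "pi / 2 \<le> u")
      case True
      then show ?thesis using IH(1) s(2) le by linarith
    next
      case False
      then show ?thesis using IH(2) down by linarith
    qed
  qed
qed

text \<open>After squaring, the cross term \<open>- 2 * sin t * cos t\<close> is nonnegative in this
  quadrant.\<close>

lemma sin_minus_cos_ge_one:
  assumes "pi / 2 \<le> t" "t \<le> pi"
  shows "1 \<le> sin t - cos t"
proof -
  have s: "0 \<le> sin t" using assms by (intro sin_ge_zero) auto
  have c: "cos t \<le> 0"
    using cos_monotone_0_pi_le[of "pi / 2" t] assms by simp
  have "1 = (sin t)\<^sup>2 + (cos t)\<^sup>2" by simp
  also have "\<dots> \<le> (sin t - cos t)\<^sup>2"
    using mult_nonneg_nonpos[OF s c] by (simp add: power2_diff mult.commute)
  finally show ?thesis using s c power2_le_imp_le[of 1 "sin t - cos t"] by simp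
qed

text \<open>Indexes the edges kept among the first \<open>m\<close> directions; the multiples of
  \<open>k\<close> are the deleted axis-parallel ones.\<close>

definition nonmultiples :: "nat \<Rightarrow> nat \<Rightarrow> nat set" where
  "nonmultiples k m = {j \<in> {1..m}. \<not> k dvd j}"

lemma finite_nonmultiples [simp]: "finite (nonmultiples k m)"
  by (simp add: nonmultiples_def)

text \<open>For \<open>k \<le> N\<close> the loss of at most 1 is repaid by the missing terms
  \<open>0\<close> and \<open>k\<close>. For \<open>N < k\<close> no argument exceeds
  \<open>pi / 2\<close>, so each minimum is the shifted sine and nothing is lost.\<close>

lemma sum_nonmultiples_sin_le_sum_min:
  fixes k :: nat
  assumes "k > 0" and h: "h = pi / (2 * real k)" and "real N * h \<le> t" "t \<le> pi" "t < real (Suc N) * h"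
  shows "(\<Sum>j\<in>nonmultiples k N. sin (t - real j * h)) \<le>
    (\<Sum>j<N. min (sin (t - real j * h)) (sin (t - real (Suc j) * h)))"
proof (cases "k \<le> N")
  case True
  have hk: "real k * h = pi / 2" and h0: "h > 0" using assms by auto
  have jle: "real j * h \<le> t" if "j \<le> N" for j
  proof -
    have "real j * h \<le> real N * h" using that h0 by (intro mult_right_mono) auto
    then show ?thesis using assms by linarith
  qed
  have nn: "0 \<le> sin (t - real j * h)" if "j \<le> N" for j
    using jle[OF that] h0 assms mult_nonneg_nonneg[of "real j" h]
    by (intro sin_ge_zero) linarith+
  have "pi / 2 \<le> t" using jle[OF True] hk by simp
  \<comment> \<open>The index \<open>2 * k\<close> may remain on the right; its term is
    nonnegative.\<close>
  have "(\<Sum>j\<in>nonmultiples k N. sin (t - real j * h)) \<le> (\<Sum>j\<in>{..N} - {0, k}. sin (t - real j * h))"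
    using nn by (intro sum_mono2) (auto simp: nonmultiples_def)
  also have "\<dots> = (\<Sum>j\<le>N. sin (t - real j * h)) - (\<Sum>j\<in>{0, k}. sin (t - real j * h))"
    using True by (intro sum_diff) auto
  also have "(\<Sum>j\<in>{0, k}. sin (t - real j * h)) = sin t - cos t"
    using assms(1) by (simp add: hk sin_diff)
  also have "(\<Sum>j\<le>N. sin (t - real j * h)) - (sin t - cos t) \<le> (\<Sum>j\<le>N. sin (t - real j * h)) - 1"
    using sin_minus_cos_ge_one[OF \<open>pi / 2 \<le> t\<close> assms(4)] by simp
  also have "\<dots> \<le> (\<Sum>j<N. min (sin (t - real j * h)) (sin (t - real (Suc j) * h)))"
    using sum_min_sin_ge[OF h0 assms(3,4)] by blast
  finally show ?thesis .
next
  case False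
  have h0: "h > 0" and hk: "real k * h = pi / 2" using assms by auto
  have "real (Suc N) * h \<le> real k * h" using False h0 by (intro mult_right_mono) auto
  then have "t \<le> pi / 2" using assms hk by linarith
  have *: "min (sin (t - real j * h)) (sin (t - real (Suc j) * h)) = sin (t - real (Suc j) * h)"
    if "j < N" for j
  proof -
    have "real (Suc j) * h \<le> real N * h" using that h0 by (intro mult_right_mono) auto
    then have "real (Suc j) * h \<le> t" using assms by linarith
    moreover have "real j * h \<le> real (Suc j) * h" "0 \<le> real j * h"
      using h0 by (auto intro!: mult_right_mono)
    ultimately have "sin (t - real (Suc j) * h) \<le> sin (t - real j * h)"
      using \<open>t \<le> pi / 2\<close> by (intro sin_monotone_2pi_le) linarith+
    then show ?thesis by simp
  qed
  have "nonmultiples k N = Suc ` {..<N}"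
    using False
    by (auto simp: nonmultiples_def image_Suc_lessThan dest: dvd_imp_le)
  then have "(\<Sum>j\<in>nonmultiples k N. sin (t - real j * h)) = (\<Sum>j<N. sin (t - real (Suc j) * h))"
    by (simp add: sum.reindex)
  then show ?thesis using * by simp
qed

section \<open>Vertices of the mangled polygon\<close>

text \<open>The subtracted sums run over exactly the multiples \<open>l * k \<le> m\<close>, so a
  vertex is a partial sum of unit edge vectors.\<close>

lemma mangled_vertex_eq:
  assumes "k > 0"
  shows "mangled_vertex k m = (\<Sum>j\<in>nonmultiples k m. cis (real j * (pi / (2 * real k))))"
proof -
  define h where "h = pi / (2 * real k)"
  have split: "(\<Sum>j=1..m. f (real j * h)) - (\<Sum>l=1..m div k. f (real l * real k * h))
     = (\<Sum>j\<in>nonmultiples k m. f (real j * h))" for f :: "real \<Rightarrow> real"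
  proof -
    have im: "{j \<in> {1..m}. k dvd j} = (\<lambda>l. l * k) ` {1..m div k}"
    proof (intro equalityI subsetI)
      fix j assume "j \<in> {j \<in> {1..m}. k dvd j}"
      then obtain l where l: "j = l * k" "1 \<le> j" "j \<le> m" by (auto simp: dvd_def mult.commute)
      then have "l \<le> m div k" using assms by (simp add: less_eq_div_iff_mult_less_eq)
      moreover have "1 \<le> l" using l by (cases l) auto
      ultimately show "j \<in> (\<lambda>l. l * k) ` {1..m div k}" using l by auto
    next
      fix j assume "j \<in> (\<lambda>l. l * k) ` {1..m div k}"
      then show "j \<in> {j \<in> {1..m}. k dvd j}"
        using assms by (auto simp: less_eq_div_iff_mult_less_eq Suc_le_eq)
    qed
    have "inj_on (\<lambda>l. l * k) {1..m div k}" using assms by (auto simp: inj_on_def)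
    then have "(\<Sum>l=1..m div k. f (real l * real k * h)) = (\<Sum>j\<in>{j \<in> {1..m}. k dvd j}. f (real j * h))"
      unfolding im by (simp add: sum.reindex)
    moreover have "nonmultiples k m = {1..m} - {j \<in> {1..m}. k dvd j}" by (auto simp: nonmultiples_def)
    moreover have "{j \<in> {1..m}. k dvd j} \<subseteq> {1..m}" by blast
    ultimately show ?thesis by (simp only: sum_diff finite_atLeastAtMost)
  qed
  show ?thesis
    unfolding mangled_vertex_def Let_def h_def[symmetric] split
    by (simp add: complex_eq_iff)
qed

text \<open>Edges \<open>j\<close> and \<open>j + 2 * k\<close> are opposite unit vectors and
  cancel.\<close>

lemma mangled_vertex_closed:
  assumes "k > 0"
  shows "mangled_vertex k (4 * k) = 0"
proof -
  define h where "h = pi / (2 * real k)"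
  have kh: "real (2 * k) * h = pi" using assms by (simp add: h_def)
  have "nonmultiples k (4 * k) = nonmultiples k (2 * k) \<union> (\<lambda>j. j + 2 * k) ` nonmultiples k (2 * k)" (is "?L = ?R")
  proof (intro equalityI subsetI)
    fix j assume j: "j \<in> ?L"
    show "j \<in> ?R"
    proof (cases "j \<le> 2 * k")
      case False
      then have "j - 2 * k \<in> nonmultiples k (2 * k)"
        using j by (auto simp: nonmultiples_def dvd_diff_nat dest!: dvd_diffD)
      then show ?thesis using False by (intro UnI2 image_eqI[of _ _ "j - 2 * k"]) auto
    qed (use j in \<open>auto simp: nonmultiples_def\<close>)
  next
    fix j assume j: "j \<in> ?R"
    have "k dvd i" if "k dvd i + 2 * k" for i
      using that by (simp add: dvd_add_left_iff)
    then show "j \<in> ?L" using j by (auto simp: nonmultiples_def)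
  qed
  moreover have "nonmultiples k (2 * k) \<inter> (\<lambda>j. j + 2 * k) ` nonmultiples k (2 * k) = {}"
    by (auto simp: nonmultiples_def)
  moreover have "inj_on (\<lambda>j. j + 2 * k) (nonmultiples k (2 * k))" by simp
  moreover have "cis (real (j + 2 * k) * h) = - cis (real j * h)" for j
    unfolding of_nat_add distrib_right kh by (simp flip: cis_mult)
  ultimately show ?thesis
    unfolding mangled_vertex_eq[OF assms] h_def[symmetric]
    by (simp add: sum.union_disjoint sum.reindex sum_negf del: of_nat_add)
qed

text \<open>As the polygon closes, each vertex is also reached from the origin by walking the
  remaining edges backwards.\<close>

lemma mangled_vertex_compl:
  assumes "k > 0" "m \<le> 4 * k"
  shows "mangled_vertex k m = - (\<Sum>j\<in>nonmultiples k (4 * k) - nonmultiples k m. cis (real j * (pi / (2 * real k))))"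
proof -
  have "nonmultiples k m \<subseteq> nonmultiples k (4 * k)" using assms by (auto simp: nonmultiples_def)
  then show ?thesis
    using mangled_vertex_closed[OF assms(1)]
    by (simp add: mangled_vertex_eq[OF assms(1)] sum_diff)
qed

text \<open>Mirroring in the imaginary axis turns edge \<open>j\<close> into edge
  \<open>4 * k - j\<close> walked backwards, so the edges after the \<open>m\<close>-th become
  initial edges in reverse order.\<close>

lemma mangled_vertex_reflect:
  assumes "k > 0" "m < 4 * k"
  shows "- cnj (mangled_vertex k m) = mangled_vertex k (4 * k - 1 - m)"
proof -
  define h where "h = pi / (2 * real k)"
  have kh: "real (4 * k) * h = 2 * pi" using assms by (simp add: h_def)
  have "- cnj (mangled_vertex k m) = (\<Sum>j\<in>nonmultiples k (4 * k) - nonmultiples k m. cis (- (real j * h)))"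
    using assms by (simp add: mangled_vertex_compl h_def cis_cnj)
  also have "\<dots> = (\<Sum>j\<in>nonmultiples k (4 * k - 1 - m). cis (real j * h))"
  \<comment> \<open>The \<open>- 1\<close> arises because \<open>j > m\<close> amounts to
    \<open>4 * k - j \<le> 4 * k - 1 - m\<close>.\<close>
  proof (rule sum.reindex_bij_witness[where i = "\<lambda>j. 4 * k - j" and j = "\<lambda>j. 4 * k - j"])
    have dv: "k dvd 4 * k - j \<longleftrightarrow> k dvd j" if "j \<le> 4 * k" for j
      using that by (meson dvd_diffD1 dvd_diff_nat dvd_triv_right)
    fix j
    show "4 * k - j \<in> nonmultiples k (4 * k - 1 - m)" if "j \<in> nonmultiples k (4 * k) - nonmultiples k m"
      using that dv[of j] by (cases "j = 4 * k") (auto simp: nonmultiples_def)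
    show "4 * k - j \<in> nonmultiples k (4 * k) - nonmultiples k m" if "j \<in> nonmultiples k (4 * k - 1 - m)"
    proof -
      have "j \<le> 4 * k" using that by (auto simp: nonmultiples_def)
      then show ?thesis using that dv[of j] assms by (auto simp: nonmultiples_def)
    qed
    show "cis (real (4 * k - j) * h) = cis (- (real j * h))"
      if "j \<in> nonmultiples k (4 * k) - nonmultiples k m"
    proof -
      have "real (4 * k - j) * h = 2 * pi - real j * h"
        using that kh by (simp add: nonmultiples_def of_nat_diff left_diff_distrib)
      then show ?thesis by (simp add: complex_eq_iff)
    qed
  qed (auto simp: nonmultiples_def)
  finally show ?thesis using assms by (simp add: mangled_vertex_eq h_def)
qed

text \<open>As \<open>j\<close> grows, the terms are nonnegative up to \<open>N\<close>, then
  nonpositive up to the angle \<open>t + pi\<close>, then nonnegative until the full turn. The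
  partial sums therefore peak at \<open>N\<close>.\<close>

lemma inner_mangled_vertex_le:
  assumes "k > 0" and h: "h = pi / (2 * real k)" and "m \<le> 4 * k" "0 \<le> t" "t \<le> pi"
    and "real N * h \<le> t" "t < real (Suc N) * h"
  shows "normal_at t \<bullet> mangled_vertex k m \<le> (\<Sum>j\<in>nonmultiples k N. sin (t - real j * h))"
proof -
  have h0: "h > 0" and kh: "real (4 * k) * h = 2 * pi" using assms by auto
  have v: "normal_at t \<bullet> mangled_vertex k m = (\<Sum>j\<in>nonmultiples k m. sin (t - real j * h))"
    using assms by (simp add: mangled_vertex_eq inner_sum_right inner_normal_at_cis)
  have mono: "real i * h \<le> real j * h" if "i \<le> j" for i j
    using that h0 by (intro mult_right_mono) auto
  have nn: "0 \<le> sin (t - real j * h)" if "j \<le> N" for j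
    using mono[OF that] h0 assms mult_nonneg_nonneg[of "real j" h]
    by (intro sin_ge_zero) linarith+
  consider "m \<le> N" | "N < m" "real m * h \<le> t + pi" | "t + pi < real m * h" by linarith
  then show ?thesis
  proof cases
    case 1
    then show ?thesis unfolding v using nn by (intro sum_mono2) (auto simp: nonmultiples_def)
  next
    case 2
    have "sin (t - real j * h) \<le> 0" if "j \<in> nonmultiples k m - nonmultiples k N" for j
    proof -
      have "Suc N \<le> j" "j \<le> m" using that by (auto simp: nonmultiples_def)
      then have "0 \<le> sin (real j * h - t)"
        using mono[of "Suc N" j] mono[of j m] assms 2 by (intro sin_ge_zero) linarith+
      then show ?thesis by (simp add: sin_diff algebra_simps)
    qed
    then have "(\<Sum>j\<in>nonmultiples k m - nonmultiples k N. sin (t - real j * h)) \<le> 0"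
      by (intro sum_nonpos)
    moreover have "nonmultiples k N \<subseteq> nonmultiples k m" using 2 by (auto simp: nonmultiples_def)
    ultimately show ?thesis unfolding v by (simp add: sum_diff)
  next
    case 3
    \<comment> \<open>The remaining edges contribute nonnegatively, so by closedness the vertex
      itself contributes at most 0.\<close>
    have "0 \<le> sin (t - real j * h)" if "j \<in> nonmultiples k (4 * k) - nonmultiples k m" for j
    proof -
      have "m \<le> j" "j \<le> 4 * k" using that by (auto simp: nonmultiples_def)
      then have "0 \<le> sin (t - real j * h + 2 * pi)"
        using mono[of m j] mono[of j "4 * k"] kh assms 3 by (intro sin_ge_zero) linarith+
      then show ?thesis by simp
    qed
    then have "0 \<le> (\<Sum>j\<in>nonmultiples k (4 * k) - nonmultiples k m. sin (t - real j * h))"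
      by (intro sum_nonneg)
    moreover have "normal_at t \<bullet> mangled_vertex k m =
      - (\<Sum>j\<in>nonmultiples k (4 * k) - nonmultiples k m. sin (t - real j * h))"
      using assms by (simp add: mangled_vertex_compl inner_sum_right inner_normal_at_cis)
    moreover have "0 \<le> (\<Sum>j\<in>nonmultiples k N. sin (t - real j * h))"
      using nn by (intro sum_nonneg) (auto simp: nonmultiples_def)
    ultimately show ?thesis by simp
  qed
qed

lemma support_ge_mangled_vertex:
  assumes "compact K" "chord_condition K (pi / (2 * real k)) \<tau>" "k > 0" "\<tau> \<ge> 0" "m \<le> 4 * k"
    and x: "x \<in> K" "normal_at \<alpha> \<in> outer_unit_normals K x"
    and "0 \<le> t" "t \<le> pi"
  shows "\<exists>p\<in>K. \<tau> * (normal_at t \<bullet> mangled_vertex k m) \<le> normal_at (\<alpha> + t) \<bullet> (p - x)"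
proof -
  define h where "h = pi / (2 * real k)"
  have "real 1 \<le> real k" using assms(3) by linarith
  then have h: "0 < h" "h < pi" using assms by (auto simp: h_def divide_less_eq)
  \<comment> \<open>The last index whose edge direction \<open>real N * h\<close> does not exceed
    \<open>t\<close>.\<close>
  define N where "N = nat \<lfloor>t / h\<rfloor>"
  have "real N \<le> t / h" "t / h < real N + 1"
    using h assms unfolding N_def by (simp_all add: of_nat_nat)
  then have N: "real N * h \<le> t" "t < real (Suc N) * h"
    using h by (simp_all add: field_simps)
  obtain p where p: "p \<in> K"
    "\<tau> * (\<Sum>j<N. min (sin (t - real j * h)) (sin (t - real (Suc j) * h)))
      \<le> normal_at (\<alpha> + t) \<bullet> (p - x)"
    using support_ge_sum_min[OF assms(1) assms(2)[folded h_def] h x N(1) assms(9)] by blast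
  have "\<tau> * (normal_at t \<bullet> mangled_vertex k m) \<le>
      \<tau> * (\<Sum>j<N. min (sin (t - real j * h)) (sin (t - real (Suc j) * h)))"
    using inner_mangled_vertex_le[OF assms(3) h_def assms(5,8,9) N]
      sum_nonmultiples_sin_le_sum_min[OF assms(3) h_def N(1) assms(9) N(2)] assms(4)
    by (intro mult_left_mono) auto
  then show ?thesis using p by force
qed

section \<open>Reflection in the imaginary axis\<close>

lemma inner_reflect: "(- cnj u) \<bullet> (- cnj w) = u \<bullet> w"
  by (simp add: inner_complex_def)

lemma normal_at_reflect: "- cnj (normal_at t) = normal_at (- t)"
  by (simp add: normal_at_def complex_eq_iff)

lemma outer_unit_normals_reflect:
  "normal_at a \<in> outer_unit_normals ((\<lambda>z. - cnj z) ` K) (- cnj p) \<longleftrightarrow>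
    normal_at (- a) \<in> outer_unit_normals K p"
proof -
  have "normal_at a \<bullet> (- cnj y - - cnj p) = normal_at (- a) \<bullet> (y - p)" for y
    using inner_reflect[of "normal_at (- a)" "y - p"] by (simp add: normal_at_reflect)
  then show ?thesis by (simp add: outer_unit_normals_def)
qed

lemma chord_condition_reflect:
  assumes "chord_condition K h \<tau>"
  shows "chord_condition ((\<lambda>z. - cnj z) ` K) h \<tau>"
  unfolding chord_condition_def
proof (intro allI impI)
  fix a b p' q'
  assume A: "p' \<in> (\<lambda>z. - cnj z) ` K" "q' \<in> (\<lambda>z. - cnj z) ` K"
    "normal_at a \<in> outer_unit_normals ((\<lambda>z. - cnj z) ` K) p'"
    "normal_at b \<in> outer_unit_normals ((\<lambda>z. - cnj z) ` K) q'" "h < b - a" "b - a \<le> pi"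
  then obtain p q where pq: "p \<in> K" "q \<in> K" "p' = - cnj p" "q' = - cnj q" by blast
  then have "normal_at (- a) \<in> outer_unit_normals K p" "normal_at (- b) \<in> outer_unit_normals K q"
    using A by (simp_all add: outer_unit_normals_reflect)
  \<comment> \<open>Negating the angles reverses their order, so \<open>p\<close> and
    \<open>q\<close> exchange roles.\<close>
  moreover have "h < - a - (- b)" "- a - (- b) \<le> pi" using A by auto
  ultimately have "\<tau> \<le> dist q p" using assms pq unfolding chord_condition_def by blast
  also have "\<dots> = dist p' q'"
    by (metis complex_cnj_diff complex_mod_cnj dist_minus dist_norm dist_commute pq(3,4))
  finally show "\<tau> \<le> dist p' q'" .
qed

section \<open>Inclusion by separation\<close>

text \<open>A vertex outside \<open>K\<close> could be strictly separated from it, but the support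
  comparison in that direction yields a point of \<open>K\<close> at least as far out.\<close>

lemma mangled_vertex_in:
  assumes "compact K" "convex K" "chord_condition K (pi / (2 * real k)) \<tau>" "k > 0" "\<tau> \<ge> 0"
    and x: "x \<in> K" "normal_at \<alpha> \<in> outer_unit_normals K x" and "m < 4 * k"
  shows "cis \<alpha> * (\<tau> *\<^sub>R mangled_vertex k m) + x \<in> K"
proof (rule ccontr)
  let ?y = "cis \<alpha> * (\<tau> *\<^sub>R mangled_vertex k m) + x"
  assume "?y \<notin> K"
  then obtain v b where v: "v \<bullet> ?y < b" "\<And>z. z \<in> K \<Longrightarrow> b < v \<bullet> z"
    using separating_hyperplane_closed_point[OF assms(2) compact_imp_closed[OF assms(1)]] by metis
  \<comment> \<open>For \<open>v = 0\<close> the separation would give both \<open>0 < b\<close> and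
    \<open>b < 0\<close>.\<close>
  then have "- v \<noteq> 0" using x by fastforce
  then obtain t where t: "- pi < t" "t \<le> pi" "- v = norm (- v) *\<^sub>R normal_at (\<alpha> + t)"
    by (rule polar_normal_at)
  have "\<exists>p\<in>K. \<tau> * (normal_at t \<bullet> mangled_vertex k m) \<le> normal_at (\<alpha> + t) \<bullet> (p - x)"
  proof (cases "0 \<le> t")
    case True
    then show ?thesis using support_ge_mangled_vertex assms t by (metis less_imp_le)
  next
    case False
    \<comment> \<open>In the mirrored body the normal angle is \<open>- \<alpha>\<close>, the
      direction \<open>- t\<close> is positive, and vertex \<open>m\<close> becomes vertex
      \<open>4 * k - 1 - m\<close>.\<close>
    let ?f = "\<lambda>z. - cnj z"
    have "compact (?f ` K)" using assms by (intro compact_continuous_image continuous_intros)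
    moreover have "normal_at (- \<alpha>) \<in> outer_unit_normals (?f ` K) (?f x)"
      using x by (simp add: outer_unit_normals_reflect)
    ultimately obtain p where p: "p \<in> K" "\<tau> * (normal_at (- t) \<bullet> mangled_vertex k (4 * k - 1 - m))
        \<le> normal_at (- \<alpha> + - t) \<bullet> (?f p - ?f x)"
      using support_ge_mangled_vertex[of "?f ` K" k \<tau> "4 * k - 1 - m" "?f x" "- \<alpha>" "- t"]
        chord_condition_reflect assms False t by auto
    have "normal_at (- t) \<bullet> mangled_vertex k (4 * k - 1 - m) = normal_at t \<bullet> mangled_vertex k m"
      using assms by (simp only: mangled_vertex_reflect[symmetric] normal_at_reflect[symmetric] inner_reflect)
    moreover have "normal_at (- \<alpha> + - t) \<bullet> (?f p - ?f x) = normal_at (\<alpha> + t) \<bullet> (p - x)"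
      using inner_reflect[of "normal_at (\<alpha> + t)" "p - x"] by (simp add: normal_at_reflect)
    ultimately show ?thesis using p by auto
  qed
  then obtain p where p: "p \<in> K" "\<tau> * (normal_at t \<bullet> mangled_vertex k m) \<le> normal_at (\<alpha> + t) \<bullet> (p - x)"
    by blast
  have "normal_at (\<alpha> + t) \<bullet> (?y - x) = \<tau> * (normal_at t \<bullet> mangled_vertex k m)"
    using inner_cis_mult by simp
  then have "normal_at (\<alpha> + t) \<bullet> (?y - x) \<le> normal_at (\<alpha> + t) \<bullet> (p - x)"
    using p(2) by linarith
  then have "normal_at (\<alpha> + t) \<bullet> ?y \<le> normal_at (\<alpha> + t) \<bullet> p"
    unfolding inner_diff_right by simp
  then have "(- v) \<bullet> ?y \<le> (- v) \<bullet> p"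
    by (subst (1 2) t(3)) (auto intro!: mult_left_mono)
  then show False using v(1) v(2)[OF p(1)] by simp
qed

theorem theorem3:
  fixes K :: "complex set" and x :: complex and \<alpha> \<phi> \<tau> :: real
  assumes "planar_convex_body K"
    and "\<tau> > 0"
    and "0 < \<phi>" and "\<phi> < pi / 4"
    and "normal_modulus K \<tau> \<le> \<phi>"
    and "x \<in> frontier K"
    and "Complex (sin \<alpha>) (- cos \<alpha>) \<in> outer_unit_normals K x"
  shows "mangled_gon x \<alpha> \<phi> \<tau> \<subseteq> K"
proof -
  define k where "k = nat \<lfloor>pi / (2 * \<phi>)\<rfloor>"
  have K: "compact K" "convex K" using assms by (auto simp: planar_convex_body_def)
  have xK: "x \<in> K" using assms(6) compact_imp_closed[OF K(1)] by (simp add: frontier_def)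
  have "2 < pi / (2 * \<phi>)" using assms by (simp add: field_simps)
  then have k: "k > 0" "real k \<le> pi / (2 * \<phi>)" unfolding k_def by linarith+
  \<comment> \<open>Rounding \<open>k\<close> down makes the angular step at least
    \<open>\<phi>\<close>, as the chord condition requires.\<close>
  then have "\<phi> \<le> pi / (2 * real k)" using assms by (simp add: field_simps)
  then have cc: "chord_condition K (pi / (2 * real k)) \<tau>"
    using assms by (intro chord_condition_modulus) auto
  \<comment> \<open>Pulling \<open>K\<close> back along the placement map gives a convex set, so
    minimality of the hull reduces the inclusion to the vertices.\<close>
  define f where "f z = cis \<alpha> * (\<tau> *\<^sub>R z) + x" for z
  have "convex ((+) (- x) ` K)" using K(2) by (rule convex_translation)
  moreover have "linear (\<lambda>z. cis \<alpha> * (\<tau> *\<^sub>R z))"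
    by (intro linearI) (simp_all add: algebra_simps)
  ultimately have "convex ((\<lambda>z. cis \<alpha> * (\<tau> *\<^sub>R z)) -` ((+) (- x) ` K))"
    by (intro convex_linear_vimage)
  also have "(\<lambda>z. cis \<alpha> * (\<tau> *\<^sub>R z)) -` ((+) (- x) ` K) = f -` K"
    by (auto simp: f_def image_iff algebra_simps)
  finally have "convex (f -` K)" .
  moreover have "mangled_vertex k ` ({1..4 * k} - {k, 2 * k, 3 * k, 4 * k}) \<subseteq> f -` K"
    using mangled_vertex_in[OF K cc k(1) _ xK] assms by (auto simp: f_def normal_at_def)
  ultimately have "standard_mangled_gon k \<subseteq> f -` K"
    unfolding standard_mangled_gon_def by (intro hull_minimal)
  then show ?thesis by (auto simp: mangled_gon_def k_def f_def)
qed

end
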